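(* For the matching utility $u_*$, there exist $k\ge 1$ and a $k\times k$ doubly stochastic matrix $M$ such that $i(\pi,M)=+\infty$, where $\pi$ is the uniform distribution on $K=\{1,\dots,k\}$ (which is an invariant distribution of $M$).
   Context: Setting: $K=\{1,\dots,k\}$ is a finite set, $\Delta(K)$ is the set of probability distributions on $K$ (viewed as $k$-dimensional row vectors), $M$ is a $k\times k$ stochastic matrix. The matching utility is $u_*:K\times K\to\{0,1\}$, $u_*(i,\ell)=\mathbf 1\{i=\ell\}$. For a prior $q\in\Delta(K)$, $\{X_j\}_{j\ge1}$ is the Markov chain on $K$ with $X_1\sim q$ and transition matrix $M$. At each stage $j=1,2,\dots$ a decision maker selects an action $\xi_j\in K$ and then observes only the binary signal $I(\xi_j)=\mathbf 1\{X_j=\xi_j\}$. A policy $\xi=(\xi_j)_{j\ge1}$ specifies each action $\xi_j$ as a (deterministic) function of the past actions $\xi_1,\dots,\xi_{j-1}$ and past signals $I(\xi_1),\dots,I(\xi_{j-1})$ (so $\xi_1$ is a fixed element of $K$). Let $\Xi$ be the set of all policies, and let $P_{q,\xi}$, $E_{q,\xi}$ denote the induced probability and expectation. The value of the $n$-stage problem is $v_n(q)=\max_{\xi\in\Xi}E_{q,\xi}[u_*(X_n,\xi_n)]=\max_{\xi\in\Xi}P_{q,\xi}(X_n=\xi_n)$. For an invariant distribution $\pi$ (i.e. $\pi M=\pi$) the sequence $v_n(\pi)$ is non-decreasing and bounded, and $v_\infty(\pi)=\lim_{n\to\infty}v_n(\pi)$. The predictive learning index is $i(\pi,M)=\min\{n\in\mathbb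 N\cup\{+\infty\}: v_n(\pi)=v_\infty(\pi)\}$, where $n=+\infty$ always belongs to the set; thus $i(\pi,M)=+\infty$ means that $v_n(\pi)\neq v_\infty(\pi)$ for every finite $n\ge1$. *)

theory Defs
  imports "HOL-Probability.Probability" "HOL-Library.Extended_Nat"
begin

(* The state space is K = {1..k}.  A k x k matrix is a function M whose entries M i j are only
   looked at for i, j in {1..k}; a distribution on K is a pmf with support inside {1..k}. *)

definition stochastic :: "nat \<Rightarrow> (nat \<Rightarrow> nat \<Rightarrow> real) \<Rightarrow> bool" where
  "stochastic k M \<longleftrightarrow>
     (\<forall>i\<in>{1..k}. \<forall>j\<in>{1..k}. 0 \<le> M i j) \<and> (\<forall>i\<in>{1..k}. (\<Sum>j=1..k. M i j) = 1)"

definition doubly_stochastic :: "nat \<Rightarrow> (nat \<Rightarrow> nat \<Rightarrow> real) \<Rightarrow> bool" where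
  "doubly_stochastic k M \<longleftrightarrow> stochastic k M \<and> (\<forall>j\<in>{1..k}. (\<Sum>i=1..k. M i j) = 1)"

definition invariant_dist :: "nat \<Rightarrow> (nat \<Rightarrow> nat \<Rightarrow> real) \<Rightarrow> nat pmf \<Rightarrow> bool" where
  "invariant_dist k M q \<longleftrightarrow>
     set_pmf q \<subseteq> {1..k} \<and> (\<forall>j\<in>{1..k}. (\<Sum>i=1..k. pmf q i * M i j) = pmf q j)"

definition row_pmf :: "nat \<Rightarrow> (nat \<Rightarrow> nat \<Rightarrow> real) \<Rightarrow> nat \<Rightarrow> nat pmf" where
  "row_pmf k M i = embed_pmf (\<lambda>j. if j \<in> {1..k} then M i j else 0)"

(* The joint law of the first n states [X_1, ..., X_n] of the chain with X_1 distributed as q and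
   transition matrix M.  As policies are deterministic and do not influence the state, this
   finite-dimensional law determines every probability and expectation about stages 1, ..., n. *)

primrec path_law :: "nat \<Rightarrow> (nat \<Rightarrow> nat \<Rightarrow> real) \<Rightarrow> nat pmf \<Rightarrow> nat \<Rightarrow> nat list pmf" where
  "path_law k M q 0 = return_pmf []"
| "path_law k M q (Suc n) =
     bind_pmf (path_law k M q n) (\<lambda>xs.
       map_pmf (\<lambda>x. xs @ [x]) (if xs = [] then q else row_pmf k M (last xs)))"

(* A policy maps the history before stage j, i.e. the chronological list of the j - 1 past pairs
   (action, signal), to the action at stage j; the stage is the length of the list plus 1. *)

type_synonym policy = "(nat \<times> bool) list \<Rightarrow> nat"

definition policies :: "nat \<Rightarrow> policy set" where
  "policies k = {\<xi>. \<forall>h \<in> lists ({1..k} \<times> UNIV). \<xi> h \<in> {1..k}}"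

(* Lists are indexed from 0: the state X_j is xs ! (j - 1). *)

primrec history :: "policy \<Rightarrow> nat list \<Rightarrow> nat \<Rightarrow> (nat \<times> bool) list" where
  "history \<xi> xs 0 = []"
| "history \<xi> xs (Suc j) =
     history \<xi> xs j @ [(\<xi> (history \<xi> xs j), xs ! j = \<xi> (history \<xi> xs j))]"

definition state_at :: "nat list \<Rightarrow> nat \<Rightarrow> nat" where
  "state_at xs j = xs ! (j - 1)"

definition action_at :: "policy \<Rightarrow> nat list \<Rightarrow> nat \<Rightarrow> nat" where
  "action_at \<xi> xs j = \<xi> (history \<xi> xs (j - 1))"

definition matching_utility :: "nat \<Rightarrow> nat \<Rightarrow> real" where
  "matching_utility i l = of_bool (i = l)"

definition payoff ::
  "(nat \<Rightarrow> nat \<Rightarrow> real) \<Rightarrow> nat \<Rightarrow> (nat \<Rightarrow> nat \<Rightarrow> real) \<Rightarrow> nat pmf \<Rightarrow> nat \<Rightarrow> policy \<Rightarrow> real" where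
  "payoff u k M q n \<xi> =
     measure_pmf.expectation (path_law k M q n) (\<lambda>xs. u (state_at xs n) (action_at \<xi> xs n))"

(* Stages are numbered from 1, so only n >= 1 is meaningful here. *)

definition stage_value ::
  "(nat \<Rightarrow> nat \<Rightarrow> real) \<Rightarrow> nat \<Rightarrow> (nat \<Rightarrow> nat \<Rightarrow> real) \<Rightarrow> nat \<Rightarrow> nat pmf \<Rightarrow> real" where
  "stage_value u k M n q = Max (payoff u k M q n ` policies k)"

definition limit_value ::
  "(nat \<Rightarrow> nat \<Rightarrow> real) \<Rightarrow> nat \<Rightarrow> (nat \<Rightarrow> nat \<Rightarrow> real) \<Rightarrow> nat pmf \<Rightarrow> real" where
  "limit_value u k M q = lim (\<lambda>n. stage_value u k M n q)"

definition learning_index ::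
  "(nat \<Rightarrow> nat \<Rightarrow> real) \<Rightarrow> nat \<Rightarrow> nat pmf \<Rightarrow> (nat \<Rightarrow> nat \<Rightarrow> real) \<Rightarrow> enat" where
  "learning_index u k q M =
     (LEAST N. N = \<infinity> \<or> (\<exists>n\<ge>1. N = enat n \<and> stage_value u k M n q = limit_value u k M q))"

lemma pmf_row_pmf:
  assumes "stochastic k M" "i \<in> {1..k}"
  shows "pmf (row_pmf k M i) j = (if j \<in> {1..k} then M i j else 0)"
  unfolding row_pmf_def
proof (rule pmf_embed_pmf)
  show "0 \<le> (if j \<in> {1..k} then M i j else 0)" for j
    using assms by (auto simp: stochastic_def)
  have "(\<integral>\<^sup>+ j. ennreal (if j \<in> {1..k} then M i j else 0) \<partial>count_space UNIV)
      = (\<integral>\<^sup>+ j. ennreal (M i j) * indicator {1..k} j \<partial>count_space UNIV)"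
    by (intro nn_integral_cong) auto
  also have "\<dots> = (\<Sum>j=1..k. ennreal (M i j))"
    by (subst nn_integral_count_space_indicator[symmetric])
       (auto intro: nn_integral_count_space_finite)
  also have "\<dots> = ennreal (\<Sum>j=1..k. M i j)"
    using assms by (intro sum_ennreal) (auto simp: stochastic_def)
  also have "\<dots> = 1"
    using assms by (auto simp: stochastic_def)
  finally show "(\<integral>\<^sup>+ j. ennreal (if j \<in> {1..k} then M i j else 0) \<partial>count_space UNIV) = 1" .
qed

lemma set_path_law:
  assumes "stochastic k M" "set_pmf q \<subseteq> {1..k}"
  shows "set_pmf (path_law k M q n) \<subseteq> {xs. set xs \<subseteq> {1..k} \<and> length xs = n}"
proof (induction n)
  case 0
  then show ?case by simp
next
  case (Suc n)
  have row: "set_pmf (row_pmf k M i) \<subseteq> {1..k}" if "i \<in> {1..k}" for i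
    using pmf_row_pmf[OF assms(1) that] by (auto simp: set_pmf_iff split: if_splits)
  show ?case
  proof
    fix zs assume "zs \<in> set_pmf (path_law k M q (Suc n))"
    then obtain xs x where xs: "xs \<in> set_pmf (path_law k M q n)" and zs: "zs = xs @ [x]"
      and x: "x \<in> set_pmf (if xs = [] then q else row_pmf k M (last xs))"
      by auto
    have *: "set xs \<subseteq> {1..k}" "length xs = n"
      using xs Suc.IH by blast+
    have "x \<in> {1..k}"
    proof (cases "xs = []")
      case True
      then show ?thesis using x assms(2) by (simp add: subset_iff)
    next
      case False
      have "last xs \<in> {1..k}" using last_in_set[OF False] *(1) by (rule rev_subsetD)
      from row[OF this] show ?thesis using x False by (simp only: if_False) (rule subsetD)
    qed
    then show "zs \<in> {xs. set xs \<subseteq> {1..k} \<and> length xs = Suc n}"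
      using * zs by simp
  qed
qed

lemma pmf_path_law_Suc:
  "pmf (path_law k M q (Suc n)) (xs @ [x]) =
     pmf (path_law k M q n) xs * pmf (if xs = [] then q else row_pmf k M (last xs)) x"
proof -
  have inj: "inj (\<lambda>x. ys @ [x])" for ys :: "nat list"
    by (auto simp: inj_on_def)
  have eq: "pmf (map_pmf (\<lambda>x. ys @ [x]) p) (xs @ [x]) = (if ys = xs then pmf p x else 0)"
    for ys and p :: "nat pmf"
  proof (cases "ys = xs")
    case True
    then show ?thesis using pmf_map_inj'[OF inj, of xs p x] by simp
  next
    case False
    then show ?thesis by (auto simp: pmf_eq_0_set_pmf)
  qed
  let ?p = "\<lambda>ys. if ys = [] then q else row_pmf k M (last ys)"
  have "pmf (path_law k M q (Suc n)) (xs @ [x]) =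
      measure_pmf.expectation (path_law k M q n) (\<lambda>ys. if ys = xs then pmf (?p ys) x else 0)"
    unfolding path_law.simps pmf_bind eq ..
  also have "\<dots> = pmf (path_law k M q n) xs * pmf (?p xs) x"
    by (subst integral_measure_pmf[where A = "{xs}"]) (auto split: if_splits)
  finally show ?thesis .
qed

lemma pmf_path_law:
  assumes "stochastic k M"
    and "length xs = Suc n" "set xs \<subseteq> {1..k}"
  shows "pmf (path_law k M q (Suc n)) xs = pmf q (xs ! 0) * (\<Prod>j<n. M (xs ! j) (xs ! Suc j))"
  using assms(2-)
proof (induction n arbitrary: xs)
  case 0
  then obtain x where xs: "xs = [x]" by (auto simp: length_Suc_conv)
  show ?case using pmf_path_law_Suc[of k M q 0 "[]" x] unfolding xs by simp
next
  case (Suc n)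
  obtain ys y where xs: "xs = ys @ [y]"
    using Suc.prems(1) by (cases xs rule: rev_cases) auto
  have len: "length ys = Suc n" and ys: "set ys \<subseteq> {1..k}" and y: "y \<in> {1..k}"
    using Suc.prems unfolding xs by auto
  have ne: "ys \<noteq> []" using len by auto
  have last: "last ys = ys ! n"
    by (subst last_conv_nth[OF ne]) (simp add: len)
  have last_in: "last ys \<in> {1..k}"
    using last_in_set[OF ne] ys by (rule rev_subsetD)
  have step: "pmf (row_pmf k M (last ys)) y = M (ys ! n) y"
    using pmf_row_pmf[OF assms(1) last_in, of y] y last by simp
  have "pmf (path_law k M q (Suc (Suc n))) xs = pmf (path_law k M q (Suc n)) ys * M (ys ! n) y"
    unfolding xs pmf_path_law_Suc using ne step by simp
  also have "pmf (path_law k M q (Suc n)) ys =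
      pmf q (ys ! 0) * (\<Prod>j<n. M (ys ! j) (ys ! Suc j))"
    by (rule Suc.IH[OF len ys])
  also have "(\<Prod>j<n. M (ys ! j) (ys ! Suc j)) = (\<Prod>j<n. M (xs ! j) (xs ! Suc j))"
    unfolding xs using len by (intro prod.cong) (auto simp: nth_append)
  finally show ?case
    unfolding xs using len by (simp add: nth_append mult.assoc)
qed

lemma policies_nonempty:
  assumes "k \<ge> 1"
  shows "policies k \<noteq> {}"
proof -
  have "(\<lambda>_. 1) \<in> policies k"
    using assms unfolding policies_def by simp
  then show ?thesis by blast
qed

lemma history_in_lists:
  assumes "\<xi> \<in> policies k"
  shows "history \<xi> xs j \<in> lists ({1..k} \<times> UNIV)"
proof (induction j)
  case 0
  show ?case by simp
next
  case (Suc j)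
  then have "\<xi> (history \<xi> xs j) \<in> {1..k}"
    using assms unfolding policies_def by blast
  with Suc show ?case by simp
qed

lemma finite_payoffs:
  assumes "stochastic k M" "set_pmf q \<subseteq> {1..k}"
  shows "finite (payoff u k M q n ` policies k)"
proof -
  let ?A = "set_pmf (path_law k M q n)"
  let ?F = "\<lambda>a. \<Sum>xs\<in>?A. pmf (path_law k M q n) xs * u (state_at xs n) (a xs)"
  have fin: "finite ?A"
    by (rule finite_subset[OF set_path_law[OF assms]]) (simp add: finite_lists_length_eq)
  have "payoff u k M q n ` policies k \<subseteq> ?F ` (?A \<rightarrow>\<^sub>E {1..k})"
  proof
    fix y assume "y \<in> payoff u k M q n ` policies k"
    then obtain \<xi> where \<xi>: "\<xi> \<in> policies k" and y: "y = payoff u k M q n \<xi>" by auto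
    let ?a = "restrict (\<lambda>xs. action_at \<xi> xs n) ?A"
    have "?a \<in> ?A \<rightarrow>\<^sub>E {1..k}"
      using \<xi> history_in_lists[OF \<xi>] unfolding policies_def action_at_def by auto
    moreover have "y = ?F ?a"
      unfolding y payoff_def using fin by (subst integral_measure_pmf[OF fin]) auto
    ultimately show "y \<in> ?F ` (?A \<rightarrow>\<^sub>E {1..k})" by blast
  qed
  then show ?thesis
    by (rule finite_subset) (intro finite_imageI finite_PiE fin, simp)
qed

end

theory Submission
  imports Defs
begin

text \<open>
  Take two blocks of two states each, the chain staying in its initial block and being uniform and
  independent inside it. A player who knows the block wins with probability \<open>1/2\<close>, and nobody does
  better. Guessing state \<open>1\<close> until the last stage reveals the block up to an error exponentially
  small in \<open>n\<close>, so the values tend to \<open>1/2\<close>. The value \<open>1/2\<close> is never attained, because the history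
  in which every guess fails has positive probability under both blocks, and the action that a
  policy takes after it is wrong for one of them.
\<close>

section \<open>Last-stage payoff and the history without a hit\<close>

lemma history_append:
  "j \<le> length ys \<Longrightarrow> history \<xi> (ys @ zs) j = history \<xi> ys j"
  by (induction j) (auto simp: nth_append)

text \<open>The action at stage \<open>Suc n\<close> depends on the first \<open>n\<close> states
  only. Conditioning on them, the chance of a match is the mass that the law of the next state gives
  to that action.\<close>

lemma payoff_matching_Suc:
  assumes "stochastic k M" "set_pmf q \<subseteq> {1..k}"
  shows "payoff matching_utility k M q (Suc n) \<xi> =
    measure_pmf.expectation (path_law k M q n)
      (\<lambda>ys. pmf (if ys = [] then q else row_pmf k M (last ys)) (\<xi> (history \<xi> ys n)))"
proof -
  let ?p = "\<lambda>ys. if ys = [] then q else row_pmf k M (last ys)"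
  let ?N = "\<lambda>ys. map_pmf (\<lambda>x. ys @ [x]) (?p ys)"
  let ?hit = "\<lambda>xs. xs ! n = \<xi> (history \<xi> xs n)"
  have "payoff matching_utility k M q (Suc n) \<xi> =
      measure_pmf.expectation (path_law k M q (Suc n)) (indicator {xs. ?hit xs})"
    unfolding payoff_def matching_utility_def state_at_def action_at_def indicator_def
    by simp
  also have "\<dots> = measure (measure_pmf (path_law k M q (Suc n))) {xs. ?hit xs}"
    by (simp only: Bochner_Integration.integral_indicator space_measure_pmf Int_UNIV_right)
  also have "\<dots> = pmf (map_pmf ?hit (path_law k M q (Suc n))) True"
    by (simp add: pmf_map vimage_def)
  also have "\<dots> = pmf (bind_pmf (path_law k M q n) (\<lambda>ys. map_pmf ?hit (?N ys))) True"
    by (simp add: map_bind_pmf)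
  also have "\<dots> = measure_pmf.expectation (path_law k M q n)
      (\<lambda>ys. pmf (map_pmf ?hit (?N ys)) True)"
    by (rule pmf_bind)
  also have "\<dots> = measure_pmf.expectation (path_law k M q n)
      (\<lambda>ys. pmf (?p ys) (\<xi> (history \<xi> ys n)))"
  \<comment> \<open>The integrands are compared only on the support: there
    \<open>length ys = n\<close>, so entry \<open>n\<close> of \<open>ys @ [x]\<close> is
    \<open>x\<close>, and the history up to stage \<open>n\<close> does not read it.\<close>
  proof (rule integral_cong_AE)
    show "AE ys in path_law k M q n.
        pmf (map_pmf ?hit (?N ys)) True = pmf (?p ys) (\<xi> (history \<xi> ys n))"
    proof (rule AE_pmfI)
      fix ys assume "ys \<in> set_pmf (path_law k M q n)"
      then have len: "length ys = n"
        using set_path_law[OF assms] by blast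
      have "pmf (map_pmf ?hit (?N ys)) True =
          measure (measure_pmf (?p ys)) {x. x = \<xi> (history \<xi> ys n)}"
        using len by (simp only: pmf.map_comp pmf_map) (simp add: vimage_def history_append nth_append)
      then show "pmf (map_pmf ?hit (?N ys)) True = pmf (?p ys) (\<xi> (history \<xi> ys n))"
        by (simp only: singleton_conv pmf.rep_eq)
    qed
  qed simp_all
  finally show ?thesis .
qed

text \<open>Both payoff bounds compare the chance of a match with such a function, \<open>x\<close>
  being a single exceptional path on which the chance may drop to 0.\<close>

lemma expectation_diff_indicator:
  "measure_pmf.expectation p (\<lambda>y. a - b * indicator {x} y) = a - b * pmf p x" for a b :: real
  by (subst Bochner_Integration.integral_diff)
    (auto simp: measure_pmf_single intro!: measure_pmf.integrable_const_bound[where B = 1])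

text \<open>No states enter here: once every signal is known to be a failure, the policy alone fixes
  the history. Hence the final action can be read off before a block is chosen.\<close>

primrec miss_history :: "policy \<Rightarrow> nat \<Rightarrow> (nat \<times> bool) list" where
  "miss_history \<xi> 0 = []"
| "miss_history \<xi> (Suc j) = miss_history \<xi> j @ [(\<xi> (miss_history \<xi> j), False)]"

text \<open>The guesses along \<open>miss_history\<close> are known in advance, so a path can dodge
  them one by one, provided \<open>B\<close> always offers a state other than the guess.\<close>

lemma exists_miss_path:
  assumes "\<And>a. \<exists>b\<in>B. b \<noteq> a"
  obtains ys where "length ys = n" "set ys \<subseteq> B" "history \<xi> ys n = miss_history \<xi> n"
proof -
  obtain f where f: "\<And>a. f a \<in> B" "\<And>a. f a \<noteq> a"
    using assms by metis
  let ?ys = "map (\<lambda>j. f (\<xi> (miss_history \<xi> j))) [0..<n]"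
  have "j \<le> n \<Longrightarrow> history \<xi> ?ys j = miss_history \<xi> j" for j
    by (induction j) (auto simp: f)
  with f show ?thesis
    by (intro that[of ?ys]) auto
qed

section \<open>The two-block chain and the law of its paths\<close>

definition two_blocks :: "nat \<Rightarrow> nat \<Rightarrow> real" where
  "two_blocks i j = (if (i \<le> 2) = (j \<le> 2) then 1/2 else 0)"

abbreviation unif :: "nat pmf" where
  "unif \<equiv> pmf_of_set {1..4}"

lemma atLeastAtMost_1_4: "{1..4} = {1, 2, 3, 4::nat}"
  by auto

lemma doubly_stochastic_two_blocks: "doubly_stochastic 4 two_blocks"
  unfolding doubly_stochastic_def stochastic_def atLeastAtMost_1_4
  by (simp add: two_blocks_def)

lemma stochastic_two_blocks: "stochastic 4 two_blocks"
  using doubly_stochastic_two_blocks by (simp add: doubly_stochastic_def)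

lemma invariant_dist_two_blocks: "invariant_dist 4 two_blocks unif"
  unfolding invariant_dist_def atLeastAtMost_1_4
  by (auto simp: two_blocks_def)

lemma set_unif: "set_pmf unif \<subseteq> {1..4}"
  by simp

lemma pmf_row_two_blocks:
  assumes "i \<in> {1..4}"
  shows "pmf (row_pmf 4 two_blocks i) j = (if j \<in> {1..4} then two_blocks i j else 0)"
  by (rule pmf_row_pmf[OF stochastic_two_blocks assms])

text \<open>The mass of a path contains its last transition as a factor. On the support this factor
  is nonzero, so no step leaves the block.\<close>

lemma set_path_two_blocks:
  assumes "xs \<in> set_pmf (path_law 4 two_blocks unif n)"
  shows "set xs \<subseteq> {1, 2} \<or> set xs \<subseteq> {3, 4}"
  using assms
proof (induction n arbitrary: xs)
  case (Suc n)
  then obtain ys x where ys: "ys \<in> set_pmf (path_law 4 two_blocks unif n)"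
    and xs: "xs = ys @ [x]" by auto
  have x: "x \<in> {1, 2, 3, 4}"
    using set_path_law[OF stochastic_two_blocks set_unif] Suc.prems
    unfolding xs atLeastAtMost_1_4 by fastforce
  show ?case
  proof (cases "ys = []")
    case True
    then show ?thesis using x by (auto simp: xs)
  next
    case False
    have last: "last ys \<in> set ys" using False by simp
    then have "last ys \<in> {1..4}"
      using set_path_law[OF stochastic_two_blocks set_unif] ys by blast
    moreover have "pmf (path_law 4 two_blocks unif (Suc n)) (ys @ [x]) \<noteq> 0"
      using Suc.prems by (simp only: xs set_pmf_iff not_False_eq_True)
    ultimately have "two_blocks (last ys) x \<noteq> 0"
      using False unfolding pmf_path_law_Suc by (auto simp: pmf_row_two_blocks split: if_splits)
    then have "(last ys \<le> 2) = (x \<le> 2)"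
      by (auto simp: two_blocks_def split: if_splits)
    with Suc.IH[OF ys] last x show ?thesis
      unfolding xs by auto
  qed
qed simp

lemma two_blocks_same_block:
  assumes "A \<subseteq> {1, 2} \<or> A \<subseteq> {3, 4}" "i \<in> A" "j \<in> A"
  shows "two_blocks i j = 1 / 2"
proof -
  have "i \<le> 2 \<longleftrightarrow> j \<le> 2"
    using assms by force
  then show ?thesis by (simp add: two_blocks_def)
qed

lemma pmf_path_two_blocks:
  assumes "xs \<noteq> []" "set xs \<subseteq> {1, 2} \<or> set xs \<subseteq> {3, 4}"
  shows "pmf (path_law 4 two_blocks unif (length xs)) xs = (1 / 2) ^ (length xs + 1)"
proof -
  obtain n where len: "length xs = Suc n" using assms(1) by (cases xs) auto
  have sub: "set xs \<subseteq> {1..4}" using assms(2) by auto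
  have "xs ! 0 \<in> set xs" using len by simp
  then have "xs ! 0 \<in> {1..4}" using sub by blast
  then have "pmf unif (xs ! 0) = 1 / 4"
    by (simp add: indicator_def)
  moreover have "two_blocks (xs ! j) (xs ! Suc j) = 1 / 2" if "j < n" for j
    using len that by (intro two_blocks_same_block[OF assms(2)] nth_mem) auto
  ultimately have "pmf unif (xs ! 0) * (\<Prod>j<n. two_blocks (xs ! j) (xs ! Suc j)) =
      1 / 4 * (\<Prod>j<n. 1 / 2)"
    by (metis (no_types, lifting) lessThan_iff prod.cong)
  \<comment> \<open>The prior contributes two factors 1/2, and the path has
    \<open>length xs - 1\<close> transitions.\<close>
  also have "\<dots> = (1 / 2) ^ (length xs + 1)"
    by (simp add: len)
  finally show ?thesis
    unfolding len by (subst pmf_path_law[OF stochastic_two_blocks len sub])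
qed

section \<open>Every payoff is strictly below 1/2\<close>

lemma payoff_two_blocks_less:
  assumes "n \<ge> 1"
  shows "payoff matching_utility 4 two_blocks unif n \<xi> < 1 / 2"
proof -
  obtain m where n: "n = Suc m" using assms by (cases n) auto
  let ?P = "path_law 4 two_blocks unif m"
  let ?f = "\<lambda>ys. pmf (if ys = [] then unif else row_pmf 4 two_blocks (last ys)) (\<xi> (history \<xi> ys m))"
  have payoff: "payoff matching_utility 4 two_blocks unif n \<xi> = measure_pmf.expectation ?P ?f"
    unfolding n by (rule payoff_matching_Suc[OF stochastic_two_blocks set_unif])
  show ?thesis
  \<comment> \<open>At the first stage there is no past state, and the uniform prior gives a guess
    mass at most 1/4. Later the law of the next state is a row of the matrix.\<close>
  proof (cases m)
    case 0
    have "payoff matching_utility 4 two_blocks unif n \<xi> = pmf unif (\<xi> [])"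
      unfolding payoff using 0 by simp
    also have "\<dots> \<le> 1 / 4"
      by (simp add: indicator_def)
    finally show ?thesis by simp
  next
    case (Suc l)
    \<comment> \<open>The block that the action after \<open>m\<close> failures does not belong to.
      A path in it that produces those failures has positive mass, and its last guess surely
      fails.\<close>
    let ?B = "if \<xi> (miss_history \<xi> m) \<le> 2 then {3, 4} else {1, 2 :: nat}"
    have "\<exists>b\<in>?B. b \<noteq> a" for a
      by (cases "a = 1 \<or> a = 3") auto
    then obtain zs where zs: "length zs = m" "set zs \<subseteq> ?B" "history \<xi> zs m = miss_history \<xi> m"
      by (rule exists_miss_path)
    have "zs \<noteq> []" using zs(1) Suc by auto
    then have last: "last zs \<in> ?B" using zs(2) last_in_set by blast
    have "set zs \<subseteq> {1, 2} \<or> set zs \<subseteq> {3, 4}"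
      using zs(2) by presburger
    from pmf_path_two_blocks[OF \<open>zs \<noteq> []\<close> this] have pos: "pmf ?P zs > 0"
      unfolding zs(1) by (simp only: zero_less_power zero_less_divide_iff zero_less_one zero_less_numeral simp_thms)
    have "last zs \<in> {1..4}" using last by (auto split: if_splits)
    moreover have "two_blocks (last zs) (\<xi> (miss_history \<xi> m)) = 0"
      using last by (auto simp: two_blocks_def split: if_splits)
    ultimately have miss: "?f zs = 0"
      using \<open>zs \<noteq> []\<close> by (simp add: zs(3) pmf_row_two_blocks)
    \<comment> \<open>Entries of the matrix never exceed 1/2, and on \<open>zs\<close> the chance of
      a match is 0.\<close>
    have "?f ys \<le> 1 / 2 - 1 / 2 * indicator {zs} ys" if "ys \<in> set_pmf ?P" for ys
    proof (cases "ys = zs")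
      case True
      then show ?thesis using miss by (simp only: indicator_simps singleton_iff)
    next
      case False
      have sub: "set ys \<subseteq> {1..4}" and len: "length ys = m"
        using set_path_law[OF stochastic_two_blocks set_unif] that by blast+
      then have ne: "ys \<noteq> []" using Suc by auto
      then have "last ys \<in> {1..4}" using sub last_in_set by blast
      with ne False show ?thesis
        by (simp add: pmf_row_two_blocks two_blocks_def)
    qed
    then have "measure_pmf.expectation ?P ?f \<le>
        measure_pmf.expectation ?P (\<lambda>ys. 1 / 2 - 1 / 2 * indicator {zs} ys)"
      by (intro integral_mono_AE AE_pmfI measure_pmf.integrable_const_bound[where B = 1])
        (auto simp: pmf_le_1 indicator_def)
    also have "\<dots> = 1 / 2 - 1 / 2 * pmf ?P zs"
      by (rule expectation_diff_indicator)
    finally show ?thesis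
      using pos payoff by simp
  qed
qed

section \<open>Policies whose payoffs approach 1/2\<close>

lemma history_constant:
  assumes "\<And>h. length h < n \<Longrightarrow> \<xi> h = a"
  shows "history \<xi> xs n = map (\<lambda>j. (a, xs ! j = a)) [0..<n]"
proof -
  have "j \<le> n \<Longrightarrow> history \<xi> xs j = map (\<lambda>j. (a, xs ! j = a)) [0..<j]" for j
    by (induction j) (auto simp: assms)
  then show ?thesis by simp
qed

text \<open>A hit on state 1 proves that the block is {1, 2}; if none occurs in \<open>m\<close>
  stages, the block {3, 4} is guessed. Only the action at stage \<open>m + 1\<close> is
  rewarded.\<close>

definition probing_policy :: "nat \<Rightarrow> policy" where
  "probing_policy m h = (if length h < m \<or> (1, True) \<in> set h then 1 else 3)"

lemma probing_policy_in_policies: "probing_policy m \<in> policies 4"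
  by (simp add: policies_def probing_policy_def)

lemma probing_policy_history:
  assumes "length ys = m"
  shows "probing_policy m (history (probing_policy m) ys m) = (if 1 \<in> set ys then 1 else 3)"
proof -
  have "history (probing_policy m) ys m = map (\<lambda>j. (1, ys ! j = 1)) [0..<m]"
    by (rule history_constant) (simp add: probing_policy_def)
  then show ?thesis
    using assms by (auto simp: probing_policy_def in_set_conv_nth image_iff)
qed

lemma payoff_probing_policy:
  assumes "m \<ge> 1"
  shows "1 / 2 - (1 / 2) ^ (m + 2) \<le>
    payoff matching_utility 4 two_blocks unif (Suc m) (probing_policy m)"
proof -
  let ?P = "path_law 4 two_blocks unif m"
  let ?\<xi> = "probing_policy m"
  let ?f = "\<lambda>ys. pmf (if ys = [] then unif else row_pmf 4 two_blocks (last ys)) (?\<xi> (history ?\<xi> ys m))"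
  \<comment> \<open>The only path of positive mass on which the block is misjudged: it lies in {1,
    2} and avoids 1. Its mass is \<open>(1 / 2) ^ (m + 1)\<close>, and it costs half of
    that.\<close>
  let ?bad = "replicate m (2 :: nat)"
  have "1 / 2 - 1 / 2 * indicator {?bad} ys \<le> ?f ys" if "ys \<in> set_pmf ?P" for ys
  proof (cases "ys = ?bad")
    case False
    have sub: "set ys \<subseteq> {1..4}" and len: "length ys = m"
      using set_path_law[OF stochastic_two_blocks set_unif] that by blast+
    then have ne: "ys \<noteq> []" using assms by auto
    then have last: "last ys \<in> set ys" by simp
    \<comment> \<open>So a path without 1 meets a state other than 1 and 2, and therefore lies in
      {3, 4}, where the guess 3 is right with chance 1/2.\<close>
    have "\<exists>y\<in>set ys. y \<noteq> 2"
      using False replicate_eqI[OF len, of 2] by blast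
    then have "two_blocks (last ys) (if 1 \<in> set ys then 1 else 3) = 1 / 2"
      using set_path_two_blocks[OF that] last by (fastforce simp: two_blocks_def)
    moreover have "last ys \<in> {1..4}"
      using sub last by blast
    ultimately show ?thesis
      using False ne by (simp add: probing_policy_history[OF len] pmf_row_two_blocks)
  qed simp
  then have "measure_pmf.expectation ?P (\<lambda>ys. 1 / 2 - 1 / 2 * indicator {?bad} ys) \<le>
      measure_pmf.expectation ?P ?f"
    by (intro integral_mono_AE AE_pmfI measure_pmf.integrable_const_bound[where B = 1])
      (auto simp: pmf_le_1 indicator_def)
  moreover have "measure_pmf.expectation ?P (\<lambda>ys. 1 / 2 - 1 / 2 * indicator {?bad} ys) =
      1 / 2 - 1 / 2 * pmf ?P ?bad"
    by (rule expectation_diff_indicator)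
  moreover have "pmf ?P ?bad = (1 / 2) ^ (m + 1)"
    using assms pmf_path_two_blocks[of ?bad] by auto
  ultimately show ?thesis
    unfolding payoff_matching_Suc[OF stochastic_two_blocks set_unif] by simp
qed

section \<open>Stage values, their limit and the index\<close>

lemma finite_payoffs_two_blocks:
  "finite (payoff matching_utility 4 two_blocks unif n ` policies 4)"
  by (rule finite_payoffs[OF stochastic_two_blocks set_unif])

text \<open>The strict bound survives the passage to the maximum because there are only finitely
  many payoffs; for a supremum of infinitely many it could become an equality.\<close>

lemma stage_value_two_blocks_less:
  assumes "n \<ge> 1"
  shows "stage_value matching_utility 4 two_blocks n unif < 1 / 2"
  unfolding stage_value_def
  using finite_payoffs_two_blocks policies_nonempty[of 4] payoff_two_blocks_less[OF assms]
  by (subst Max_less_iff) auto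

lemma stage_value_two_blocks_ge:
  assumes "m \<ge> 1"
  shows "1 / 2 - (1 / 2) ^ (m + 2) \<le> stage_value matching_utility 4 two_blocks (Suc m) unif"
proof -
  have "payoff matching_utility 4 two_blocks unif (Suc m) (probing_policy m) \<le>
      stage_value matching_utility 4 two_blocks (Suc m) unif"
    unfolding stage_value_def
    by (intro Max_ge finite_payoffs_two_blocks imageI probing_policy_in_policies)
  with payoff_probing_policy[OF assms] show ?thesis by (rule order_trans)
qed

lemma limit_value_two_blocks: "limit_value matching_utility 4 two_blocks unif = 1 / 2"
proof -
  let ?v = "\<lambda>n. stage_value matching_utility 4 two_blocks n unif"
  \<comment> \<open>The lower bound starts at stage 2, so the sequence is shifted:
    \<open>m = n + 1\<close> gives stage \<open>n + 2\<close> and exponent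
    \<open>n + 3\<close>.\<close>
  have "(\<lambda>n. 1 / 2 - (1 / 2) ^ (n + 3) :: real) \<longlonglongrightarrow> 1 / 2 - 0"
    by (intro tendsto_diff tendsto_const LIMSEQ_ignore_initial_segment LIMSEQ_power_zero) simp
  then have lower: "(\<lambda>n. 1 / 2 - (1 / 2) ^ (n + 3) :: real) \<longlonglongrightarrow> 1 / 2"
    by (simp only: diff_zero)
  have "1 / 2 - (1 / 2) ^ (n + 3) \<le> ?v (n + 2)" for n
    using stage_value_two_blocks_ge[of "n + 1"] by (simp add: eval_nat_numeral)
  moreover have "?v (n + 2) \<le> 1 / 2" for n
    using stage_value_two_blocks_less[of "n + 2"] by simp
  ultimately have "(\<lambda>n. ?v (n + 2)) \<longlonglongrightarrow> 1 / 2"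
    by (intro tendsto_sandwich[OF _ _ lower tendsto_const] always_eventually allI)
  then have "?v \<longlonglongrightarrow> 1 / 2"
    by (rule LIMSEQ_offset)
  then show ?thesis
    unfolding limit_value_def by (rule limI)
qed

theorem proposition1:
  shows "\<exists>k\<ge>1. \<exists>M :: nat \<Rightarrow> nat \<Rightarrow> real. doubly_stochastic k M \<and>
           invariant_dist k M (pmf_of_set {1..k}) \<and>
           learning_index matching_utility k (pmf_of_set {1..k}) M = \<infinity>"
proof -
  have "stage_value matching_utility 4 two_blocks n unif \<noteq>
      limit_value matching_utility 4 two_blocks unif" if "n \<ge> 1" for n
    using stage_value_two_blocks_less[OF that] limit_value_two_blocks by simp
  then have "learning_index matching_utility 4 unif two_blocks = (LEAST N. N = \<infinity>)"
    unfolding learning_index_def by (intro arg_cong[where f = Least] ext) auto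
  also have "\<dots> = \<infinity>"
    by (rule Least_equality) auto
  finally have "learning_index matching_utility 4 unif two_blocks = \<infinity>" .
  with doubly_stochastic_two_blocks invariant_dist_two_blocks show ?thesis
    by (intro exI[of _ 4] conjI exI[of _ two_blocks]) auto
qed

end
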